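(* Let $\mathbb{A}$ be a finite affine plane of odd order $p$, and consider the switching game on $\mathbb{A}$. Then every configuration with at least one lit bulb is reducible.
   Context: A finite affine plane of order $p$ has $p^2$ points and $p^2+p$ lines, each line contains $p$ points, each point lies on $p+1$ lines, any two points lie on exactly one line, and for each line $L$ and point $P$ not on $L$ there is a unique line through $P$ not meeting $L$ (parallel to $L$). The switching game: there is one light bulb at each point, each either on (lit) or off; there is one switch for each line, and flipping the switch of a line toggles the state of every bulb at a point of that line. A configuration is an assignment of on/off states to all bulbs. A configuration is reducible if some finite sequence of switch flips produces a configuration with strictly fewer lit bulbs than the initial one. *)

theory Defs
  imports Main
begin

text \<open>
  A plane is an incidence structure with an abstract type of lines; \<open>inc x l\<close> means that
  the point \<open>x\<close> lies on the line \<open>l\<close>.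
\<close>

locale finite_affine_plane =
  fixes Points :: "'p set"
    and Lines :: "'l set"
    and inc :: "'p \<Rightarrow> 'l \<Rightarrow> bool"
    and p :: nat
  assumes finite_Points: "finite Points"
    and finite_Lines: "finite Lines"
    and card_Points: "card Points = p ^ 2"
    and card_Lines: "card Lines = p ^ 2 + p"
    and card_points_on_line: "l \<in> Lines \<Longrightarrow> card {x \<in> Points. inc x l} = p"
    and card_lines_through_point: "x \<in> Points \<Longrightarrow> card {l \<in> Lines. inc x l} = p + 1"
    and unique_join:
      "x \<in> Points \<Longrightarrow> y \<in> Points \<Longrightarrow> x \<noteq> y \<Longrightarrow> \<exists>!l. l \<in> Lines \<and> inc x l \<and> inc y l"
    and unique_parallel:
      "l \<in> Lines \<Longrightarrow> x \<in> Points \<Longrightarrow> \<not> inc x l \<Longrightarrow>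
        \<exists>!m. m \<in> Lines \<and> inc x m \<and> \<not> (\<exists>y \<in> Points. inc y l \<and> inc y m)"

text \<open>
  A configuration is a predicate on bulbs, \<open>True\<close> meaning lit; its values outside
  \<open>Points\<close> are irrelevant.
\<close>

type_synonym 'p configuration = "'p \<Rightarrow> bool"

definition lit :: "'p set \<Rightarrow> 'p configuration \<Rightarrow> 'p set" where
  "lit Points c = {x \<in> Points. c x}"

definition flip ::
  "'p set \<Rightarrow> ('p \<Rightarrow> 'l \<Rightarrow> bool) \<Rightarrow> 'l \<Rightarrow> 'p configuration \<Rightarrow> 'p configuration" where
  "flip Points inc l c = (\<lambda>x. if x \<in> Points \<and> inc x l then \<not> c x else c x)"

definition reducible ::
  "'p set \<Rightarrow> 'l set \<Rightarrow> ('p \<Rightarrow> 'l \<Rightarrow> bool) \<Rightarrow> 'p configuration \<Rightarrow> bool" where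
  "reducible Points Lines inc c \<longleftrightarrow>
    (\<exists>ls. set ls \<subseteq> Lines \<and>
      card (lit Points (fold (flip Points inc) ls c)) < card (lit Points c))"

end

theory Submission
  imports Defs
begin

text \<open>
  Call a set of points switchable if some sequence of flips toggles exactly its bulbs. For a point
  \<open>x\<close>, flipping all \<open>p + 1\<close> lines through \<open>x\<close> toggles \<open>x\<close> an even number of times and every other
  point once, so the complement of \<open>x\<close> is switchable. Combining the complements of \<open>x\<close> and \<open>y\<close>
  shows that \<open>{x, y}\<close> is switchable, hence so is every set of even size. Since a line through \<open>x\<close>
  has \<open>p - 1\<close> points besides \<open>x\<close>, also \<open>{x}\<close> is switchable, so any lit bulb can be turned off alone.
\<close>

definition toggle :: "'p set \<Rightarrow> 'p configuration \<Rightarrow> 'p configuration" where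
  "toggle A c = (\<lambda>x. c x \<noteq> (x \<in> A))"

lemma toggle_empty: "toggle {} c = c"
  by (simp add: toggle_def)

lemma toggle_toggle: "toggle B (toggle A c) = toggle (sym_diff A B) c"
  by (auto simp: toggle_def)

lemma flip_eq_toggle: "flip Points inc l c = toggle {x \<in> Points. inc x l} c"
  by (auto simp: flip_def toggle_def)

lemma lit_toggle_singleton:
  assumes "x \<in> lit Points c"
  shows "lit Points (toggle {x} c) = lit Points c - {x}"
  using assms by (auto simp: lit_def toggle_def)

locale switching_game =
  fixes Points :: "'p set"
    and Lines :: "'l set"
    and inc :: "'p \<Rightarrow> 'l \<Rightarrow> bool"
begin

definition switchable :: "'p set \<Rightarrow> bool" where
  "switchable A \<longleftrightarrow> (\<exists>ls. set ls \<subseteq> Lines \<and> (\<forall>c. fold (flip Points inc) ls c = toggle A c))"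

lemma switchable_empty: "switchable {}"
  unfolding switchable_def by (rule exI [of _ "[]"]) (simp add: toggle_empty)

lemma switchable_line:
  assumes "l \<in> Lines"
  shows "switchable {x \<in> Points. inc x l}"
  unfolding switchable_def using assms
  by (intro exI [of _ "[l]"]) (simp add: flip_eq_toggle)

lemma switchable_sym_diff:
  assumes "switchable A" and "switchable B"
  shows "switchable (sym_diff A B)"
proof -
  obtain ls ms
    where "set ls \<subseteq> Lines" and "\<And>c. fold (flip Points inc) ls c = toggle A c"
      and "set ms \<subseteq> Lines" and "\<And>c. fold (flip Points inc) ms c = toggle B c"
    using assms unfolding switchable_def by blast
  then have "set (ls @ ms) \<subseteq> Lines"
    and "\<And>c. fold (flip Points inc) (ls @ ms) c = toggle (sym_diff A B) c"
    by (simp_all add: toggle_toggle)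
  then show ?thesis
    unfolding switchable_def by blast
qed

lemma switchable_odd_incidence:
  assumes "finite S" and "S \<subseteq> Lines"
  shows "switchable {x \<in> Points. odd (card {l \<in> S. inc x l})}"
  using assms
proof (induction S rule: finite_induct)
  case empty
  then show ?case
    by (simp add: switchable_empty)
next
  case (insert l S)
  have "{m \<in> insert l S. inc x m} = (if inc x l then insert l {m \<in> S. inc x m} else {m \<in> S. inc x m})"
    for x
    by auto
  then have "{x \<in> Points. odd (card {m \<in> insert l S. inc x m})} =
      sym_diff {x \<in> Points. odd (card {m \<in> S. inc x m})} {x \<in> Points. inc x l}"
    using insert.hyps by auto
  then show ?case
    using insert by (simp add: switchable_sym_diff switchable_line)
qed

lemma switchable_even_card:
  assumes "finite A" and "even (card A)"
    and "\<And>x y. x \<in> A \<Longrightarrow> y \<in> A \<Longrightarrow> x \<noteq> y \<Longrightarrow> switchable {x, y}"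
  shows "switchable A"
  using assms
proof (induction A rule: finite_psubset_induct)
  case (psubset A)
  show ?case
  proof (cases "A = {}")
    case True
    then show ?thesis
      by (simp add: switchable_empty)
  next
    case False
    then obtain x where "x \<in> A"
      by blast
    moreover have "A \<noteq> {x}"
      using psubset.prems(1) by auto
    ultimately obtain y where "y \<in> A" "x \<noteq> y"
      by blast
    with \<open>x \<in> A\<close> have "even (card (A - {x, y}))"
      using psubset.hyps psubset.prems(1) by (simp add: card_Diff_subset)
    with \<open>x \<in> A\<close> have "switchable (A - {x, y})"
      by (intro psubset.IH [of "A - {x, y}"] psubset.prems(2)) auto
    moreover have "switchable {x, y}"
      using \<open>x \<in> A\<close> \<open>y \<in> A\<close> \<open>x \<noteq> y\<close> by (rule psubset.prems(2))
    ultimately have "switchable (sym_diff (A - {x, y}) {x, y})"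
      by (rule switchable_sym_diff)
    moreover have "sym_diff (A - {x, y}) {x, y} = A"
      using \<open>x \<in> A\<close> \<open>y \<in> A\<close> by blast
    ultimately show ?thesis
      by (simp only:)
  qed
qed

lemma reducible_if_switchable_singleton:
  assumes "finite Points" and "x \<in> lit Points c" and "switchable {x}"
  shows "reducible Points Lines inc c"
proof -
  obtain ls where "set ls \<subseteq> Lines" and "fold (flip Points inc) ls c = toggle {x} c"
    using \<open>switchable {x}\<close> unfolding switchable_def by blast
  moreover have "finite (lit Points c)"
    using \<open>finite Points\<close> by (simp add: lit_def)
  then have "card (lit Points (toggle {x} c)) < card (lit Points c)"
    using \<open>x \<in> lit Points c\<close> by (simp only: lit_toggle_singleton card_Diff1_less)
  ultimately show ?thesis
    unfolding reducible_def by metis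
qed

end

sublocale finite_affine_plane \<subseteq> switching_game Points Lines inc .

context finite_affine_plane
begin

lemma card_common_lines:
  assumes "x \<in> Points" and "y \<in> Points" and "x \<noteq> y"
  shows "card {l \<in> Lines. inc x l \<and> inc y l} = 1"
  using unique_join [OF assms] by (simp add: card_1_singleton_iff) blast

lemma switchable_Diff_singleton:
  assumes "odd p" and "x \<in> Points"
  shows "switchable (Points - {x})"
proof -
  let ?pencil = "{l \<in> Lines. inc x l}"
  have "odd (card {l \<in> ?pencil. inc y l}) \<longleftrightarrow> y \<noteq> x" if "y \<in> Points" for y
    using that assms card_lines_through_point card_common_lines [of x y]
    by (cases "y = x") simp_all
  then have "{y \<in> Points. odd (card {l \<in> ?pencil. inc y l})} = Points - {x}"
    by blast
  moreover have "switchable {y \<in> Points. odd (card {l \<in> ?pencil. inc y l})}"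
    using finite_Lines by (intro switchable_odd_incidence) auto
  ultimately show ?thesis
    by simp
qed

lemma switchable_pair:
  assumes "odd p" and "x \<in> Points" and "y \<in> Points" and "x \<noteq> y"
  shows "switchable {x, y}"
proof -
  have "switchable (sym_diff (Points - {x}) (Points - {y}))"
    using assms by (intro switchable_sym_diff switchable_Diff_singleton)
  moreover have "sym_diff (Points - {x}) (Points - {y}) = {x, y}"
    using assms by blast
  ultimately show ?thesis
    by (simp only:)
qed

lemma switchable_singleton:
  assumes "odd p" and "x \<in> Points"
  shows "switchable {x}"
proof -
  have "card {l \<in> Lines. inc x l} \<noteq> 0"
    using card_lines_through_point [OF \<open>x \<in> Points\<close>] by simp
  then obtain l where "l \<in> Lines" "inc x l"
    by (auto simp: card_eq_0_iff)
  let ?L = "{y \<in> Points. inc y l}"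
  have "x \<in> ?L"
    using \<open>x \<in> Points\<close> \<open>inc x l\<close> by simp
  then have "even (card (?L - {x}))"
    using \<open>odd p\<close> card_points_on_line [OF \<open>l \<in> Lines\<close>] by (simp only: card_Diff_singleton) simp
  then have "switchable (?L - {x})"
    using finite_Points \<open>odd p\<close> by (intro switchable_even_card [of "?L - {x}"] switchable_pair) auto
  with switchable_line [OF \<open>l \<in> Lines\<close>] have "switchable (sym_diff ?L (?L - {x}))"
    by (rule switchable_sym_diff)
  moreover have "sym_diff ?L (?L - {x}) = {x}"
    using \<open>x \<in> ?L\<close> by blast
  ultimately show ?thesis
    by (simp only:)
qed

end

theorem theorem4:
  fixes Points :: "'p set"
    and Lines :: "'l set"
    and inc :: "'p \<Rightarrow> 'l \<Rightarrow> bool"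
    and p :: nat
    and c :: "'p configuration"
  assumes "finite_affine_plane Points Lines inc p"
    and "odd p"
    and "lit Points c \<noteq> {}"
  shows "reducible Points Lines inc c"
proof -
  interpret finite_affine_plane Points Lines inc p by fact
  obtain x where "x \<in> lit Points c"
    using \<open>lit Points c \<noteq> {}\<close> by blast
  moreover from this have "switchable {x}"
    using \<open>odd p\<close> by (intro switchable_singleton) (simp_all add: lit_def)
  ultimately show ?thesis
    by (rule reducible_if_switchable_singleton [OF finite_Points])
qed

end
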